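(* Let $\chi$ be a character of $B_n$. If $\mathcal{B}$ and $\mathcal{B}'$ are finite sets endowed with maps $\mathrm{sDes}:\mathcal{B}\to\Sigma^B(n)$ and $\mathrm{sDes}:\mathcal{B}'\to\Sigma^B(n)$, both of which are fine sets for $\chi$, then $|\{b\in\mathcal{B}:\mathrm{sDes}(b)=\sigma\}|=|\{b\in\mathcal{B}':\mathrm{sDes}(b)=\sigma\}|$ for every $\sigma\in\Sigma^B(n)$; that is, the distribution of $\mathrm{sDes}$ over a fine set for $\chi$ is uniquely determined by $\chi$.
   Context: A signed set is a pair $\sigma=(S,\varepsilon)$ with $n\in S\subseteq[n]$ and $\varepsilon:S\to\{-,+\}$; $\Sigma^B(n)$ is the set of these; its sign vector is $\tilde\varepsilon(j)=\varepsilon(\min\{s\in S:s\ge j\})$ for $j\in[n]$. A signed composition of $n$ is a composition $(\gamma_1,\dots,\gamma_k)$ of $n$ with some parts barred; let $r_i=\gamma_1+\dots+\gamma_i$, $r_0=0$, $S(\gamma)=\{r_1,\dots,r_k\}$, $I_i=\{r_{i-1}+1,\dots,r_i\}$. The weight $\mathrm{wt}_\gamma(\sigma)$ is $0$ if for some $i$ the set $S\cap\{r_{i-1}+1,\dots,r_i-1\}$ is not an initial segment of $\{r_{i-1}+1,\dots,r_i-1\}$ or $\tilde\varepsilon$ is not constant on $I_i$; otherwise it is $(-1)^{|S\setminus S(\gamma)|+n_\gamma(\sigma)}$, where $n_\gamma(\sigma)$ is the number of $i$ with $\tilde\varepsilon=-$ on $I_i$ and $\gamma_i$ barred. For a class function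 $\chi$ on $B_n$, $\chi(\gamma)$ is its value at elements of signed cycle type $(\alpha,\beta)$, $\alpha$ (resp. $\beta$) the decreasing rearrangement of the unbarred (resp. barred) parts of $\gamma$ (the signed cycle type of $w\in B_n$, viewed as a permutation of $\{1,\dots,n,\bar1,\dots,\bar n\}$, records lengths of positive cycles — pairs of disjoint cycles $c,\bar c$ — and of negative cycles $c=\bar c$, the latter counted with half their length). A set $\mathcal B$ with a map $\mathrm{sDes}:\mathcal B\to\Sigma^B(n)$ is a fine set for $\chi$ if $\chi(\gamma)=\sum_{b\in\mathcal B}\mathrm{wt}_\gamma(\mathrm{sDes}(b))$ for all signed compositions $\gamma$ of $n$. *)

theory Defs
  imports Complex_Main "HOL-Library.FuncSet" "HOL-Library.Multiset"
    "HOL-Combinatorics.Permutations" "HOL-Combinatorics.Orbits"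
    "Jordan_Normal_Form.Matrix"
begin

subsection \<open>Signed sets\<close>

datatype sign = Minus | Plus

type_synonym signed_set = "nat set \<times> (nat \<Rightarrow> sign)"

text \<open>The sign map has domain \<open>S\<close>; it is made extensional so that equality of pairs is
  equality of signed sets.\<close>

definition signed_sets :: "nat \<Rightarrow> signed_set set" where
  "signed_sets n = {(S, \<epsilon>). n \<in> S \<and> S \<subseteq> {1..n} \<and> \<epsilon> \<in> S \<rightarrow>\<^sub>E UNIV}"

definition sign_vector :: "signed_set \<Rightarrow> nat \<Rightarrow> sign" where
  "sign_vector \<sigma> j = snd \<sigma> (Min {s \<in> fst \<sigma>. s \<ge> j})"

subsection \<open>Signed compositions and weights\<close>

text \<open>A part is a pair of its size and a flag telling whether it is barred.\<close>

type_synonym signed_composition = "(nat \<times> bool) list"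

definition signed_compositions :: "nat \<Rightarrow> signed_composition set" where
  "signed_compositions n = {\<gamma>. (\<forall>p \<in> set \<gamma>. fst p > 0) \<and> sum_list (map fst \<gamma>) = n}"

definition psum :: "signed_composition \<Rightarrow> nat \<Rightarrow> nat" where
  "psum \<gamma> i = sum_list (map fst (take i \<gamma>))"

text \<open>Blocks are numbered \<open>1, \<dots>, length \<gamma>\<close>, so that the \<open>i\<close>-th part is \<open>\<gamma> ! (i - 1)\<close>.\<close>

definition comp_set :: "signed_composition \<Rightarrow> nat set" where
  "comp_set \<gamma> = psum \<gamma> ` {1..length \<gamma>}"

definition block :: "signed_composition \<Rightarrow> nat \<Rightarrow> nat set" where
  "block \<gamma> i = {psum \<gamma> (i - 1) + 1..psum \<gamma> i}"

definition block_interior :: "signed_composition \<Rightarrow> nat \<Rightarrow> nat set" where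
  "block_interior \<gamma> i = {psum \<gamma> (i - 1) + 1..psum \<gamma> i - 1}"

definition barred :: "signed_composition \<Rightarrow> nat \<Rightarrow> bool" where
  "barred \<gamma> i = snd (\<gamma> ! (i - 1))"

definition initial_segment :: "nat set \<Rightarrow> nat set \<Rightarrow> bool" where
  "initial_segment T U \<longleftrightarrow> T \<subseteq> U \<and> (\<forall>x \<in> T. \<forall>y \<in> U. y \<le> x \<longrightarrow> y \<in> T)"

definition neg_barred_count :: "signed_composition \<Rightarrow> signed_set \<Rightarrow> nat" where
  "neg_barred_count \<gamma> \<sigma> =
     card {i \<in> {1..length \<gamma>}. (\<forall>j \<in> block \<gamma> i. sign_vector \<sigma> j = Minus) \<and> barred \<gamma> i}"

definition wt :: "signed_composition \<Rightarrow> signed_set \<Rightarrow> int" where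
  "wt \<gamma> \<sigma> =
     (if \<exists>i \<in> {1..length \<gamma>}.
           \<not> initial_segment (fst \<sigma> \<inter> block_interior \<gamma> i) (block_interior \<gamma> i) \<or>
           \<not> (\<exists>s. \<forall>j \<in> block \<gamma> i. sign_vector \<sigma> j = s)
      then 0
      else (-1) ^ (card (fst \<sigma> - comp_set \<gamma>) + neg_barred_count \<gamma> \<sigma>))"

subsection \<open>The hyperoctahedral group and its characters\<close>

text \<open>The barred letter \<open>\<bar>i\<close> is represented by the integer \<open>-i\<close>. Permutations are the
  identity outside the ground set, and the group operation is composition.\<close>

definition signed_letters :: "nat \<Rightarrow> int set" where
  "signed_letters n = {- int n..int n} - {0}"

definition hyperoctahedral :: "nat \<Rightarrow> (int \<Rightarrow> int) set" where
  "hyperoctahedral n =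
     {w. w permutes signed_letters n \<and> (\<forall>i \<in> signed_letters n. w (- i) = - w i)}"

definition is_representation :: "nat \<Rightarrow> nat \<Rightarrow> ((int \<Rightarrow> int) \<Rightarrow> complex mat) \<Rightarrow> bool" where
  "is_representation n d \<rho> \<longleftrightarrow>
     (\<forall>w \<in> hyperoctahedral n. \<rho> w \<in> carrier_mat d d) \<and>
     \<rho> id = 1\<^sub>m d \<and>
     (\<forall>u \<in> hyperoctahedral n. \<forall>v \<in> hyperoctahedral n. \<rho> (u \<circ> v) = \<rho> u * \<rho> v)"

definition mat_trace :: "complex mat \<Rightarrow> complex" where
  "mat_trace A = (\<Sum>i<dim_row A. A $$ (i, i))"

definition is_character :: "nat \<Rightarrow> ((int \<Rightarrow> int) \<Rightarrow> complex) \<Rightarrow> bool" where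
  "is_character n \<chi> \<longleftrightarrow>
     (\<exists>d \<rho>. is_representation n d \<rho> \<and> (\<forall>w \<in> hyperoctahedral n. \<chi> w = mat_trace (\<rho> w)))"

subsection \<open>Signed cycle types\<close>

text \<open>A cycle is identified with its set of letters. A positive cycle is a pair \<open>{c, \<bar>c}\<close> of
  disjoint cycles, of length \<open>card c\<close>, i.e. half the number of letters in \<open>c \<union> \<bar>c\<close>.\<close>

definition cycles_of :: "nat \<Rightarrow> (int \<Rightarrow> int) \<Rightarrow> int set set" where
  "cycles_of n w = orbit w ` signed_letters n"

definition positive_cycles :: "nat \<Rightarrow> (int \<Rightarrow> int) \<Rightarrow> int set set set" where
  "positive_cycles n w = {{c, uminus ` c} |c. c \<in> cycles_of n w \<and> c \<inter> uminus ` c = {}}"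

definition negative_cycles :: "nat \<Rightarrow> (int \<Rightarrow> int) \<Rightarrow> int set set" where
  "negative_cycles n w = {c \<in> cycles_of n w. c = uminus ` c}"

definition decreasing :: "nat multiset \<Rightarrow> nat list" where
  "decreasing M = rev (sorted_list_of_multiset M)"

definition signed_cycle_type :: "nat \<Rightarrow> (int \<Rightarrow> int) \<Rightarrow> nat list \<times> nat list" where
  "signed_cycle_type n w =
     (decreasing (image_mset (\<lambda>P. card (\<Union> P) div 2) (mset_set (positive_cycles n w))),
      decreasing (image_mset (\<lambda>c. card c div 2) (mset_set (negative_cycles n w))))"

definition composition_type :: "signed_composition \<Rightarrow> nat list \<times> nat list" where
  "composition_type \<gamma> =
     (decreasing (mset (map fst (filter (\<lambda>p. \<not> snd p) \<gamma>))),
      decreasing (mset (map fst (filter snd \<gamma>))))"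

subsection \<open>Fine sets\<close>

text \<open>The value \<open>\<chi>(\<gamma>)\<close> is \<open>\<chi> w\<close> for any \<open>w\<close> whose signed cycle type is that of \<open>\<gamma>\<close>.\<close>

definition fine_set ::
  "nat \<Rightarrow> ((int \<Rightarrow> int) \<Rightarrow> complex) \<Rightarrow> 'b set \<Rightarrow> ('b \<Rightarrow> signed_set) \<Rightarrow> bool" where
  "fine_set n \<chi> B sDes \<longleftrightarrow>
     sDes \<in> B \<rightarrow> signed_sets n \<and>
     (\<forall>\<gamma> \<in> signed_compositions n. \<forall>w \<in> hyperoctahedral n.
        signed_cycle_type n w = composition_type \<gamma> \<longrightarrow>
        \<chi> w = (\<Sum>b\<in>B. of_int (wt \<gamma> (sDes b))))"

end

theory Submission
  imports Defs
begin

text \<open>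
  A signed set is encoded as a word whose \<open>j\<close>-th letter records whether \<open>j \<in> S\<close> and the sign
  \<open>\<epsilon>~(j)\<close>. The weight of \<open>\<gamma>\<close> is then a product of weights of consecutive factors of the word,
  and combining a barred with an unbarred part isolates the factors of one fixed sign \<open>v\<close>. Let \<open>c\<close> be
  the difference of the two distributions, so that \<open>c\<close> is orthogonal to all weights. Splitting off
  the first part of \<open>\<gamma>\<close> and using induction on the length shows, with \<open>F\<close> the letter of sign \<open>v\<close>
  outside \<open>S\<close>, that replacing every letter of a prefix of constant sign \<open>v\<close> by \<open>F\<close> changes \<open>c\<close> only
  by a sign. If the prefix is a maximal run, the resulting word encodes no signed set, because \<open>S\<close>
  contains \<open>n\<close> and every position where the sign changes; so \<open>c = 0\<close>.
  Finally, every signed composition is the cycle type of some element of \<open>B\<^sub>n\<close>, so that fineness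
  really does constrain all weights.
\<close>

subsection \<open>Words and their weights\<close>

type_synonym word = "(bool \<times> sign) list"

definition words :: "nat \<Rightarrow> word set" where
  "words n = {xs. length xs = n}"

text \<open>A position outside \<open>S\<close> takes its sign from the next element of
  \<open>S\<close>, so its successor exists and has the same sign.\<close>

fun valid :: "word \<Rightarrow> bool" where
  "valid [] = True"
| "valid (x # xs) = ((fst x \<or> (xs \<noteq> [] \<and> snd (hd xs) = snd x)) \<and> valid xs)"

definition monochrome :: "sign \<Rightarrow> word \<Rightarrow> bool" where
  "monochrome v u \<longleftrightarrow> (\<forall>x\<in>set u. snd x = v)"

definition front_loaded :: "word \<Rightarrow> bool" where
  "front_loaded u \<longleftrightarrow> sorted_wrt (\<lambda>x y. fst y \<longrightarrow> fst x) u"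

definition descent_sign :: "word \<Rightarrow> int" where
  "descent_sign u = (-1) ^ length (filter fst u)"

text \<open>\<open>butlast\<close> appears because the end of a block lies in
  \<open>S(\<gamma>)\<close>: it is neither interior nor counted in the exponent. Hence the weight
  does not see whether the last position is in \<open>S\<close>.\<close>

definition sign_block_wt :: "sign \<Rightarrow> word \<Rightarrow> int" where
  "sign_block_wt v u =
     (if monochrome v u \<and> front_loaded (butlast u) then descent_sign (butlast u) else 0)"

text \<open>On a nonempty factor at most one summand is nonzero. Writing the case distinction as a
  sum allows barred and unbarred parts to be combined linearly.\<close>

definition block_wt :: "bool \<Rightarrow> word \<Rightarrow> int" where
  "block_wt b u = sign_block_wt Plus u + (if b then -1 else 1) * sign_block_wt Minus u"

fun word_wt :: "signed_composition \<Rightarrow> word \<Rightarrow> int" where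
  "word_wt [] xs = 1"
| "word_wt (p # \<gamma>) xs = block_wt (snd p) (take (fst p) xs) * word_wt \<gamma> (drop (fst p) xs)"

section \<open>Sums over words of fixed length\<close>

lemma finite_words: "finite (words n)"
proof -
  have "finite (UNIV :: sign set)"
    by (rule finite_subset[of _ "{Minus, Plus}"]) (auto intro: sign.exhaust)
  then have "finite (UNIV :: (bool \<times> sign) set)"
    by (simp add: finite_prod)
  then show ?thesis
    using finite_lists_length_eq[of "UNIV :: (bool \<times> sign) set" n] by (simp add: words_def)
qed

lemma sum_words_append:
  fixes f :: "word \<Rightarrow> int"
  shows "(\<Sum>xs\<in>words (m + k). f xs) = (\<Sum>u\<in>words m. \<Sum>y\<in>words k. f (u @ y))"
proof -
  have "(\<Sum>xs\<in>words (m + k). f xs) = (\<Sum>(u, y)\<in>words m \<times> words k. f (u @ y))"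
    by (rule sum.reindex_bij_witness[of _ "\<lambda>(u, y). u @ y" "\<lambda>xs. (take m xs, drop m xs)"])
      (auto simp: words_def)
  then show ?thesis
    by (simp add: sum.cartesian_product)
qed

lemma valid_appendD: "valid (u @ y) \<Longrightarrow> valid y"
  by (induction u) auto

text \<open>The last of the replicated letters lies outside \<open>S\<close> but has no successor of
  its own sign.\<close>

lemma not_valid_replicate_append:
  assumes "m > 0" "y = [] \<or> snd (hd y) \<noteq> v"
  shows "\<not> valid (replicate m (False, v) @ y)"
  using assms
proof (induction m)
  case (Suc m)
  then show ?case by (cases m) auto
qed simp

lemma word_wt_separates:
  fixes c :: "word \<Rightarrow> int"
  assumes "\<And>xs. length xs = n \<Longrightarrow> \<not> valid xs \<Longrightarrow> c xs = 0"
    and "\<And>\<gamma>. \<gamma> \<in> signed_compositions n \<Longrightarrow> (\<Sum>xs\<in>words n. word_wt \<gamma> xs * c xs) = 0"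
    and "length xs = n"
  shows "c xs = 0"
  using assms
proof (induction n arbitrary: c xs rule: less_induct)
  case (less n)
  note supp = less.prems(1) and orth = less.prems(2)
  \<comment> \<open>Viewed as a function of the suffix \<open>y\<close>, this sum satisfies both
    hypotheses for the smaller length \<open>k\<close>: suffixes of valid words are valid, and
    prepending the part \<open>(m, b)\<close> to a composition of \<open>k\<close> gives one of
    \<open>n\<close>.\<close>
  have block0: "(\<Sum>u\<in>words m. block_wt b u * c (u @ y)) = 0"
    if m: "0 < m" and k: "m + k = n" and y: "length y = k" for m k b y
  proof (rule less.IH[of k "\<lambda>y. \<Sum>u\<in>words m. block_wt b u * c (u @ y)"])
    show "k < n" using m k by simp
    show "(\<Sum>u\<in>words m. block_wt b u * c (u @ z)) = 0" if "length z = k" "\<not> valid z" for z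
    proof (rule sum.neutral, intro ballI)
      fix u assume "u \<in> words m"
      then have "c (u @ z) = 0"
        using that k by (intro supp) (auto simp: words_def dest: valid_appendD)
      then show "block_wt b u * c (u @ z) = 0" by simp
    qed
    show "(\<Sum>z\<in>words k. word_wt \<gamma> z * (\<Sum>u\<in>words m. block_wt b u * c (u @ z))) = 0"
      if "\<gamma> \<in> signed_compositions k" for \<gamma>
    proof -
      have "(m, b) # \<gamma> \<in> signed_compositions n"
        using that m k by (auto simp: signed_compositions_def)
      then have "0 = (\<Sum>xs\<in>words (m + k). word_wt ((m, b) # \<gamma>) xs * c xs)"
        unfolding k by (rule orth[symmetric])
      also have "\<dots> = (\<Sum>u\<in>words m. \<Sum>z\<in>words k. word_wt \<gamma> z * (block_wt b u * c (u @ z)))"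
        unfolding sum_words_append
        by (intro sum.cong refl) (auto simp: words_def)
      also have "\<dots> = (\<Sum>z\<in>words k. \<Sum>u\<in>words m. word_wt \<gamma> z * (block_wt b u * c (u @ z)))"
        by (rule sum.swap)
      finally show ?thesis by (simp add: sum_distrib_left)
    qed
    show "length y = k" by (rule y)
  qed
  have sign0: "(\<Sum>u\<in>words m. sign_block_wt v u * c (u @ y)) = 0"
    if "0 < m" "m + length y = n" for m y v
  proof -
    let ?s = "\<lambda>v. \<Sum>u\<in>words m. sign_block_wt v u * c (u @ y)"
    have "(\<Sum>u\<in>words m. block_wt b u * c (u @ y))
        = ?s Plus + (if b then -1 else 1) * ?s Minus" for b
      by (auto simp: block_wt_def algebra_simps sum.distrib sum_subtractf sum_negf)
    then have "?s Plus + ?s Minus = 0" "?s Plus - ?s Minus = 0"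
      using block0[OF that refl, of False] block0[OF that refl, of True] by auto
    then show ?thesis by (cases v) auto
  qed
  \<comment> \<open>Induction on \<open>m\<close>: the first \<open>m\<close> letters are
    straightened by the induction hypothesis, with the last letter moved into the suffix. It remains
    to compare the two choices of that last letter, \<open>?d True\<close> and
    \<open>?d False\<close>.\<close>
  have straighten: "c (u @ y) = descent_sign u * c (replicate m (False, v) @ y)"
    if "length u = m" "monochrome v u" "m + length y = n" for m u y v
    using that
  proof (induction m arbitrary: u y)
    case 0
    then show ?case by (simp add: descent_sign_def)
  next
    case (Suc m)
    let ?d = "\<lambda>t. c (replicate m (False, v) @ (t, v) # y)"
    let ?P = "{u \<in> words m. monochrome v u \<and> front_loaded u}"
    have letter: "a = (True, Plus) \<or> a = (False, Plus) \<or> a = (True, Minus) \<or> a = (False, Minus)"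
      for a :: "bool \<times> sign"
      by (cases a; cases "fst a"; cases "snd a") auto
    have w1: "words 1 = {[(True, Plus)], [(False, Plus)], [(True, Minus)], [(False, Minus)]}"
    proof (rule Set.set_eqI)
      fix x :: word
      show "x \<in> words 1 \<longleftrightarrow>
          x \<in> {[(True, Plus)], [(False, Plus)], [(True, Minus)], [(False, Minus)]}"
        using letter[of "hd x"] by (cases x) (auto simp: words_def)
    qed
    have pull: "c (u @ (t, v) # y) = descent_sign u * ?d t"
      if "length u = m" "monochrome v u" for u t
      using Suc.IH[OF that, of "(t, v) # y"] Suc.prems by simp
    have "0 = (\<Sum>u\<in>words (m + 1). sign_block_wt v u * c (u @ y))"
      using sign0[of "m + 1" y v] Suc.prems by simp
    also have "\<dots> = (\<Sum>u\<in>words m. \<Sum>a\<in>words 1. sign_block_wt v (u @ a) * c (u @ a @ y))"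
      by (simp only: sum_words_append append_assoc)
    \<comment> \<open>Each admissible \<open>u\<close> contributes the same amount: its weight
      \<open>descent_sign u\<close> cancels the sign produced by straightening, and the last letter,
      of sign \<open>v\<close>, is free in its first component.\<close>
    also have "\<dots> = (\<Sum>u\<in>words m. if u \<in> ?P then ?d True + ?d False else 0)"
    proof (rule sum.cong)
      fix u assume u: "u \<in> words m"
      have "(\<Sum>a\<in>words 1. sign_block_wt v (u @ a) * c (u @ a @ y))
          = (if u \<in> ?P then descent_sign u * c (u @ (True, v) # y)
               + descent_sign u * c (u @ (False, v) # y) else 0)"
        using u unfolding w1 by (cases v) (auto simp: sign_block_wt_def monochrome_def)
      also have "\<dots> = (if u \<in> ?P then ?d True + ?d False else 0)"
      proof -
        have "descent_sign u * descent_sign u = 1"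
          by (simp add: descent_sign_def flip: power_add)
        then show ?thesis
          using pull[of u] u by (auto simp: words_def simp flip: mult.assoc)
      qed
      finally show "(\<Sum>a\<in>words 1. sign_block_wt v (u @ a) * c (u @ a @ y))
          = (if u \<in> ?P then ?d True + ?d False else 0)" .
    qed simp
    also have "\<dots> = int (card ?P) * (?d True + ?d False)"
      using finite_words[of m] by (simp add: sum.inter_filter[symmetric])
    finally have *: "int (card ?P) * (?d True + ?d False) = 0" by simp
    \<comment> \<open>A witness that \<open>?P\<close> is nonempty, so that the factor
      \<open>card ?P\<close> can be cancelled.\<close>
    have "replicate m (False, v) \<in> ?P"
      by (auto simp: words_def monochrome_def front_loaded_def sorted_wrt_iff_nth_less)
    then have "card ?P \<noteq> 0"
      using finite_words[of m] by auto
    with * have d: "?d True = - ?d False" by simp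
    obtain u' t where u: "u = u' @ [(t, v)]" "length u' = m" "monochrome v u'"
      using Suc.prems by (cases u rule: rev_cases) (auto simp: monochrome_def)
    have "c (u @ y) = descent_sign u' * ?d t"
      using pull[OF u(2,3)] u(1) by simp
    also have "\<dots> = descent_sign u * ?d False"
      using d by (auto simp: u(1) descent_sign_def)
    also have "replicate m (False, v) @ (False, v) # y = replicate (Suc m) (False, v) @ y"
      by (simp add: replicate_app_Cons_same)
    finally show ?case .
  qed
  show ?case
  proof (cases xs)
    case Nil
    \<comment> \<open>The empty composition has weight 1 on the only word of length 0, so
      orthogonality already reads \<open>c [] = 0\<close>.\<close>
    have "[] \<in> signed_compositions 0" "words 0 = {[]}"
      by (auto simp: signed_compositions_def words_def)
    then show ?thesis
      using orth[of "[]"] less.prems(3) Nil by simp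
  next
    case (Cons x xs')
    define v where "v = snd x"
    \<comment> \<open>The maximal initial run of sign \<open>v\<close>; maximality is what makes the
      straightened word invalid.\<close>
    define u where "u = takeWhile (\<lambda>x. snd x = v) xs"
    define y where "y = dropWhile (\<lambda>x. snd x = v) xs"
    have xs: "xs = u @ y" by (simp add: u_def y_def)
    have "monochrome v u"
      by (auto simp: u_def monochrome_def dest: set_takeWhileD)
    then have "c xs = descent_sign u * c (replicate (length u) (False, v) @ y)"
      using straighten[of u "length u" v y] less.prems(3) xs by simp
    moreover have "y = [] \<or> snd (hd y) \<noteq> v"
      using hd_dropWhile[of "\<lambda>x. snd x = v" xs] by (auto simp: y_def)
    moreover have "length u > 0" by (simp add: u_def Cons v_def)
    ultimately show ?thesis
      using supp[of "replicate (length u) (False, v) @ y"] not_valid_replicate_append[of "length u" y v]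
        less.prems(3) xs by auto
  qed
qed

subsection \<open>Encoding signed sets as words\<close>

text \<open>The whole signed set is encoded by \<open>segment \<sigma> 0 n\<close>; the offset
  \<open>a\<close> gives direct access to the factor on any block.\<close>

definition segment :: "signed_set \<Rightarrow> nat \<Rightarrow> nat \<Rightarrow> word" where
  "segment \<sigma> a m = map (\<lambda>j. (j \<in> fst \<sigma>, sign_vector \<sigma> j)) [Suc a..<Suc (a + m)]"

lemma length_segment [simp]: "length (segment \<sigma> a m) = m"
  by (simp add: segment_def)

lemma nth_segment: "i < m \<Longrightarrow> segment \<sigma> a m ! i = (a + i + 1 \<in> fst \<sigma>, sign_vector \<sigma> (a + i + 1))"
  by (simp add: segment_def del: upt_Suc)

lemma take_segment: "take m (segment \<sigma> a (m + k)) = segment \<sigma> a m"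
  by (rule nth_equalityI) (auto simp: nth_segment)

lemma drop_segment: "drop m (segment \<sigma> a (m + k)) = segment \<sigma> (a + m) k"
  by (rule nth_equalityI) (auto simp: nth_segment ac_simps)

lemma butlast_segment: "butlast (segment \<sigma> a m) = segment \<sigma> a (m - 1)"
  by (rule nth_equalityI) (auto simp: nth_segment nth_butlast)

lemma monochrome_segment:
  "monochrome s (segment \<sigma> a m) \<longleftrightarrow> (\<forall>j\<in>{a + 1..a + m}. sign_vector \<sigma> j = s)"
  by (auto simp: monochrome_def segment_def simp del: upt_Suc)

lemma front_loaded_segment:
  "front_loaded (segment \<sigma> a m) \<longleftrightarrow>
     initial_segment (fst \<sigma> \<inter> {a + 1..a + m}) {a + 1..a + m}" (is "?L \<longleftrightarrow> ?R")
proof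
  assume L: ?L
  show ?R
    unfolding initial_segment_def
  proof (intro conjI ballI impI)
    fix x y assume xy: "x \<in> fst \<sigma> \<inter> {a + 1..a + m}" "y \<in> {a + 1..a + m}" "y \<le> x"
    show "y \<in> fst \<sigma> \<inter> {a + 1..a + m}"
    proof (cases "y = x")
      case False
      then have ij: "y - a - 1 < x - a - 1" "x - a - 1 < m" using xy by auto
      then have "fst (segment \<sigma> a m ! (x - a - 1)) \<longrightarrow> fst (segment \<sigma> a m ! (y - a - 1))"
        using L by (auto simp: front_loaded_def sorted_wrt_iff_nth_less)
      then show ?thesis using xy ij by (simp add: nth_segment)
    qed (use xy in simp)
  qed simp
next
  assume R: ?R
  have "a + i + 1 \<in> fst \<sigma>" if "i < j" "j < m" "a + j + 1 \<in> fst \<sigma>" for i j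
  proof -
    have "a + j + 1 \<in> fst \<sigma> \<inter> {a + 1..a + m}" "a + i + 1 \<in> {a + 1..a + m}" "a + i + 1 \<le> a + j + 1"
      using that by auto
    then show ?thesis using R unfolding initial_segment_def by blast
  qed
  then show ?L
    by (simp add: front_loaded_def sorted_wrt_iff_nth_less nth_segment)
qed

lemma descent_sign_segment:
  "descent_sign (segment \<sigma> a m) = (-1) ^ card (fst \<sigma> \<inter> {a + 1..a + m})"
proof -
  have "length (filter fst (segment \<sigma> a m)) = length (filter (\<lambda>j. j \<in> fst \<sigma>) [Suc a..<Suc (a + m)])"
    by (simp add: segment_def filter_map comp_def del: upt_Suc)
  also have "\<dots> = card (set (filter (\<lambda>j. j \<in> fst \<sigma>) [Suc a..<Suc (a + m)]))"
    by (rule distinct_card[symmetric]) (simp del: upt_Suc)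
  also have "set (filter (\<lambda>j. j \<in> fst \<sigma>) [Suc a..<Suc (a + m)]) = fst \<sigma> \<inter> {a + 1..a + m}"
    by auto
  finally show ?thesis by (simp add: descent_sign_def)
qed

lemma block_wt_segment:
  assumes "m > 0"
  shows "block_wt b (segment \<sigma> a m) =
    (if \<not> initial_segment (fst \<sigma> \<inter> {a + 1..a + m - 1}) {a + 1..a + m - 1} \<or>
        \<not> (\<exists>s. \<forall>j\<in>{a + 1..a + m}. sign_vector \<sigma> j = s)
     then 0
     else (-1) ^ (card (fst \<sigma> \<inter> {a + 1..a + m - 1}) +
       (if (\<forall>j\<in>{a + 1..a + m}. sign_vector \<sigma> j = Minus) \<and> b then 1 else 0)))"
proof -
  have eq: "a + (m - 1) = a + m - 1" using assms by simp
  have ne: "a + 1 \<in> {a + 1..a + m}" using assms by simp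
  have s: "sign_block_wt s (segment \<sigma> a m) =
      (if (\<forall>j\<in>{a + 1..a + m}. sign_vector \<sigma> j = s) \<and>
          initial_segment (fst \<sigma> \<inter> {a + 1..a + m - 1}) {a + 1..a + m - 1}
       then (-1) ^ card (fst \<sigma> \<inter> {a + 1..a + m - 1}) else 0)" for s
    unfolding sign_block_wt_def butlast_segment monochrome_segment front_loaded_segment
      descent_sign_segment eq ..
  have ex: "(\<exists>s. M s) \<longleftrightarrow> M Plus \<or> M Minus" for M :: "sign \<Rightarrow> bool"
    by (metis (full_types) sign.exhaust)
  \<comment> \<open>A nonempty block cannot be constant of both signs, so the two summands of
    \<open>block_wt\<close> never contribute together.\<close>
  have "\<not> ((\<forall>j\<in>{a + 1..a + m}. sign_vector \<sigma> j = Plus) \<and> (\<forall>j\<in>{a + 1..a + m}. sign_vector \<sigma> j = Minus))"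
  proof
    assume "(\<forall>j\<in>{a + 1..a + m}. sign_vector \<sigma> j = Plus) \<and> (\<forall>j\<in>{a + 1..a + m}. sign_vector \<sigma> j = Minus)"
    then have "sign_vector \<sigma> (a + 1) = Plus" "sign_vector \<sigma> (a + 1) = Minus" using ne by blast+
    then show False by simp
  qed
  then show ?thesis
    unfolding block_wt_def s ex
    by (cases "\<forall>j\<in>{a + 1..a + m}. sign_vector \<sigma> j = Plus";
        cases "\<forall>j\<in>{a + 1..a + m}. sign_vector \<sigma> j = Minus") (simp_all add: power_add del: One_nat_def)
qed

section \<open>Partial sums and factorization of the weight over blocks\<close>

lemma psum_0 [simp]: "psum \<gamma> 0 = 0"
  by (simp add: psum_def)

lemma psum_Suc: "i < length \<gamma> \<Longrightarrow> psum \<gamma> (Suc i) = psum \<gamma> i + fst (\<gamma> ! i)"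
  by (simp add: psum_def take_Suc_conv_app_nth)

lemma psum_mono: "i \<le> j \<Longrightarrow> psum \<gamma> i \<le> psum \<gamma> j"
proof -
  assume "i \<le> j"
  then have "take j \<gamma> = take i \<gamma> @ drop i (take j \<gamma>)"
    by (metis append_take_drop_id min.absorb1 take_take)
  then show ?thesis by (metis le_add1 map_append psum_def sum_list_append)
qed

lemma word_wt_segment:
  "word_wt \<gamma> (segment \<sigma> a (sum_list (map fst \<gamma>))) =
     (\<Prod>i<length \<gamma>. block_wt (snd (\<gamma> ! i)) (segment \<sigma> (a + psum \<gamma> i) (fst (\<gamma> ! i))))"
proof (induction \<gamma> arbitrary: a)
  case (Cons p \<gamma>)
  have "psum (p # \<gamma>) (Suc i) = fst p + psum \<gamma> i" for i
    by (simp add: psum_def)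
  then show ?case
    by (simp add: take_segment drop_segment Cons.IH prod.lessThan_Suc_shift add.assoc
        del: prod.lessThan_Suc)
qed simp

text \<open>Each block is its interior plus its endpoint, and only the endpoints are removed.
  Positive parts make the partial sums strictly increasing, so endpoints and interiors stay
  disjoint.\<close>

lemma card_diff_psum_image:
  assumes pos: "\<forall>p\<in>set \<gamma>. fst p > 0" and "k \<le> length \<gamma>"
  shows "card (S \<inter> {1..psum \<gamma> k} - psum \<gamma> ` {1..k}) =
    (\<Sum>i\<in>{1..k}. card (S \<inter> block_interior \<gamma> i))"
  using assms(2)
proof (induction k)
  case (Suc k)
  have lt: "psum \<gamma> k < psum \<gamma> (Suc k)"
    using pos Suc.prems by (simp add: psum_Suc)
  have le: "psum \<gamma> i \<le> psum \<gamma> k" if "i \<le> k" for i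
    using that by (rule psum_mono)
  have eq: "S \<inter> {1..psum \<gamma> (Suc k)} - psum \<gamma> ` {1..Suc k} =
      (S \<inter> {1..psum \<gamma> k} - psum \<gamma> ` {1..k}) \<union> (S \<inter> block_interior \<gamma> (Suc k))"
    using lt le by (fastforce simp: block_interior_def atLeastAtMostSuc_conv)
  show ?case
    unfolding eq using Suc
    by (subst card_Un_disjoint) (auto simp: block_interior_def)
qed simp

lemma prod_if_zero_else_sign:
  fixes k :: "'a \<Rightarrow> nat"
  assumes "finite A"
  shows "(\<Prod>i\<in>A. if Q i then 0 else (-1) ^ k i) =
    (if \<exists>i\<in>A. Q i then 0 else (-1 :: int) ^ (\<Sum>i\<in>A. k i))"
  using assms by (induction A rule: finite_induct) (auto simp: power_add)

text \<open>The weight is a product over blocks: a bad block gives a zero factor, and otherwise the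
  exponents of the block signs add up to the two counts in \<open>wt\<close>.\<close>

lemma wt_eq_word_wt:
  assumes \<gamma>: "\<gamma> \<in> signed_compositions n" and \<sigma>: "\<sigma> \<in> signed_sets n"
  shows "wt \<gamma> \<sigma> = word_wt \<gamma> (segment \<sigma> 0 n)"
proof -
  let ?Q = "\<lambda>i. \<not> initial_segment (fst \<sigma> \<inter> block_interior \<gamma> i) (block_interior \<gamma> i) \<or>
           \<not> (\<exists>s. \<forall>j \<in> block \<gamma> i. sign_vector \<sigma> j = s)"
  let ?N = "\<lambda>i. (\<forall>j \<in> block \<gamma> i. sign_vector \<sigma> j = Minus) \<and> barred \<gamma> i"
  let ?k = "\<lambda>i. card (fst \<sigma> \<inter> block_interior \<gamma> i) + (if ?N i then 1 else 0)"
  have pos: "\<forall>p\<in>set \<gamma>. fst p > 0" and n: "sum_list (map fst \<gamma>) = n"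
    using \<gamma> by (auto simp: signed_compositions_def)
  have psn: "psum \<gamma> (length \<gamma>) = n" by (simp add: psum_def n)
  have sub: "fst \<sigma> \<inter> {1..n} = fst \<sigma>" using \<sigma> by (auto simp: signed_sets_def)
  have "word_wt \<gamma> (segment \<sigma> 0 n) =
      (\<Prod>i<length \<gamma>. block_wt (snd (\<gamma> ! i)) (segment \<sigma> (psum \<gamma> i) (fst (\<gamma> ! i))))"
    using word_wt_segment[of \<gamma> \<sigma> 0] n by simp
  also have "\<dots> = (\<Prod>i<length \<gamma>. if ?Q (Suc i) then 0 else (-1) ^ ?k (Suc i))"
  proof (rule prod.cong)
    fix i assume "i \<in> {..<length \<gamma>}"
    then have i: "i < length \<gamma>" by simp
    then have "fst (\<gamma> ! i) > 0" using pos by simp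
    then show "block_wt (snd (\<gamma> ! i)) (segment \<sigma> (psum \<gamma> i) (fst (\<gamma> ! i))) =
        (if ?Q (Suc i) then 0 else (-1) ^ ?k (Suc i))"
      by (subst block_wt_segment) (simp_all only: block_def block_interior_def barred_def
          psum_Suc[OF i] diff_Suc_1)
  qed simp
  \<comment> \<open>Passage from list indices, starting at 0, to block numbers, starting at
    1.\<close>
  also have "\<dots> = (\<Prod>i\<in>{1..length \<gamma>}. if ?Q i then 0 else (-1) ^ ?k i)"
    by (simp only: One_nat_def prod.atLeast1_atMost_eq)
  also have "\<dots> = (if \<exists>i\<in>{1..length \<gamma>}. ?Q i then 0 else (-1) ^ (\<Sum>i\<in>{1..length \<gamma>}. ?k i))"
    by (rule prod_if_zero_else_sign) simp
  also have "(\<Sum>i\<in>{1..length \<gamma>}. ?k i) = card (fst \<sigma> - comp_set \<gamma>) + neg_barred_count \<gamma> \<sigma>"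
  proof -
    have "(\<Sum>i\<in>{1..length \<gamma>}. if ?N i then 1 else 0) = neg_barred_count \<gamma> \<sigma>"
      by (simp add: neg_barred_count_def sum.If_cases Int_def)
    then show ?thesis
      using card_diff_psum_image[OF pos order_refl, of "fst \<sigma>"]
      unfolding sum.distrib psn sub comp_set_def by simp
  qed
  finally show ?thesis by (simp only: wt_def)
qed

section \<open>Validity and injectivity of the encoding\<close>

lemma valid_iff_nth:
  "valid xs \<longleftrightarrow> (\<forall>i<length xs. fst (xs ! i) \<or>
     (Suc i < length xs \<and> snd (xs ! Suc i) = snd (xs ! i)))"
proof (induction xs)
  case (Cons x xs)
  then show ?case
    by (cases xs) (auto simp: All_less_Suc2 hd_conv_nth)
qed simp

lemma valid_segment:
  assumes "\<sigma> \<in> signed_sets n"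
  shows "valid (segment \<sigma> 0 n)"
  unfolding valid_iff_nth
proof (intro allI impI)
  fix i assume "i < length (segment \<sigma> 0 n)"
  then have i: "i < n" by simp
  have n: "n \<in> fst \<sigma>" using assms by (auto simp: signed_sets_def)
  show "fst (segment \<sigma> 0 n ! i) \<or> Suc i < length (segment \<sigma> 0 n) \<and>
      snd (segment \<sigma> 0 n ! Suc i) = snd (segment \<sigma> 0 n ! i)"
  proof (cases "Suc i \<in> fst \<sigma>")
    case True
    then show ?thesis using i by (simp add: nth_segment)
  next
    case False
    \<comment> \<open>A position outside \<open>S\<close> is not \<open>n\<close>, and the elements
      of \<open>S\<close> from it onwards are those from its successor onwards; hence both positions
      have the same sign.\<close>
    with n i have "Suc i < n" by (metis Suc_lessI)
    moreover have "{s \<in> fst \<sigma>. Suc i \<le> s} = {s \<in> fst \<sigma>. Suc (Suc i) \<le> s}"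
      using False by (auto simp: Suc_le_eq) (metis Suc_lessI)
    ultimately show ?thesis by (simp add: nth_segment sign_vector_def)
  qed
qed

text \<open>The first components recover \<open>S\<close>. On \<open>S\<close> the sign vector
  agrees with the sign map, which is extensional and so determined by its values there.\<close>

lemma segment_inj_on: "inj_on (\<lambda>\<sigma>. segment \<sigma> 0 n) (signed_sets n)"
proof (rule inj_onI)
  fix \<sigma> \<tau> assume \<sigma>: "\<sigma> \<in> signed_sets n" and \<tau>: "\<tau> \<in> signed_sets n"
    and eq: "segment \<sigma> 0 n = segment \<tau> 0 n"
  have *: "(j \<in> fst \<sigma> \<longleftrightarrow> j \<in> fst \<tau>) \<and> sign_vector \<sigma> j = sign_vector \<tau> j" if "j \<in> {1..n}" for j
    using arg_cong[OF eq, of "\<lambda>xs. xs ! (j - 1)"] that by (auto simp: nth_segment)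
  have self: "sign_vector \<rho> j = snd \<rho> j" if "\<rho> \<in> signed_sets n" "j \<in> fst \<rho>" for \<rho> j
  proof -
    have "fst \<rho> \<subseteq> {1..n}" using that(1) by (auto simp: signed_sets_def)
    then have "finite (fst \<rho>)" by (rule finite_subset) simp
    then have "Min {s \<in> fst \<rho>. j \<le> s} = j" using that(2) by (intro Min_eqI) auto
    then show ?thesis by (simp add: sign_vector_def)
  qed
  have S: "fst \<sigma> = fst \<tau>" using * \<sigma> \<tau> by (auto simp: signed_sets_def)
  moreover have "snd \<sigma> = snd \<tau>"
  proof (rule extensionalityI)
    show "snd \<sigma> \<in> extensional (fst \<sigma>)" "snd \<tau> \<in> extensional (fst \<sigma>)"
      using \<sigma> \<tau> S by (auto simp: signed_sets_def PiE_def)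
    show "snd \<sigma> j = snd \<tau> j" if "j \<in> fst \<sigma>" for j
    proof -
      have "j \<in> {1..n}" using that \<sigma> by (auto simp: signed_sets_def)
      then show ?thesis using * self[OF \<sigma>, of j] self[OF \<tau>, of j] that S by simp
    qed
  qed
  ultimately show "\<sigma> = \<tau>" by (rule prod_eqI)
qed

subsection \<open>Elements with prescribed signed cycle type\<close>

lemma finite_signed_letters: "finite (signed_letters n)"
  by (simp add: signed_letters_def)

text \<open>On the fresh letters \<open>A\<close> one takes the shift \<open>x + 1\<close>, closed
  up at the top by \<open>n + 1\<close> or by its negative, and extends it oddly. The first choice
  gives a pair of mirror cycles, the second a single cycle through \<open>A\<close> and its mirror
  image.\<close>

lemma hyperoctahedral_extend_cycle:
  assumes w': "w' \<in> hyperoctahedral n" and m: "m > 0"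
  defines "A \<equiv> {int n + 1..int (n + m)}"
  shows "\<exists>w \<in> hyperoctahedral (n + m). cycles_of (n + m) w =
      cycles_of n w' \<union> (if b then {A \<union> uminus ` A} else {A, uminus ` A})"
proof -
  define h where "h = (if b then - (int n + 1) else int n + 1)"
  define g where "g x = (if x < int (n + m) then x + 1 else h)" for x
  define w where "w x = (if x \<in> A then g x else if - x \<in> A then - g (- x) else w' x)" for x
  have h: "h = int n + 1 \<or> h = - (int n + 1)" by (simp add: h_def)
  let ?L = "signed_letters n"
  let ?N = "uminus ` A"
  have N: "x \<in> ?N \<longleftrightarrow> - x \<in> A" for x by (metis (no_types) image_iff minus_minus)
  have letters: "signed_letters (n + m) = ?L \<union> (A \<union> ?N)"
    by (auto simp: signed_letters_def A_def)
  have disj: "?L \<inter> (A \<union> ?N) = {}" and disjA: "A \<inter> ?N = {}"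
    by (auto simp: signed_letters_def A_def)
  have perm': "w' permutes ?L" and odd': "\<And>i. i \<in> ?L \<Longrightarrow> w' (- i) = - w' i"
    using w' by (auto simp: hyperoctahedral_def)
  have wL: "w x = w' x" if "x \<notin> A \<union> ?N" for x
    using that N by (simp add: w_def)
  have wL': "w x = w' x" if "x \<in> ?L" for x
    using that disj by (intro wL) blast
  have bijL: "bij_betw w ?L ?L"
    using permutes_imp_bij[OF perm'] bij_betw_cong[OF wL', of ?L] by simp
  have maps: "w ` (A \<union> ?N) \<subseteq> A \<union> ?N"
    using h m by (auto simp: N w_def g_def A_def split: if_splits)
  have inj_g: "x = y" if "x \<in> A" "y \<in> A" "g x = g y" for x y
    using that h by (auto simp: g_def A_def split: if_splits)
  \<comment> \<open>The values of \<open>g\<close> have distinct nonzero absolute values, so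
    \<open>g\<close> never collides with its odd mirror on \<open>?N\<close>.\<close>
  have neg_g: "g x \<noteq> - g y" if "x \<in> A" "y \<in> A" for x y
    using that h by (auto simp: g_def A_def)
  have inj: "inj_on w (A \<union> ?N)"
  proof (rule inj_onI)
    fix x y assume "x \<in> A \<union> ?N" "y \<in> A \<union> ?N" and eq: "w x = w y"
    then have xy: "x \<in> A \<or> - x \<in> A" "y \<in> A \<or> - y \<in> A" using N by auto
    have nA: "- z \<notin> A" if "z \<in> A" for z using that by (auto simp: A_def)
    have "- g (- x) \<noteq> g y" if "- x \<in> A" "y \<in> A"
      using neg_g[OF that(2,1)] by simp
    then show "x = y"
      using xy eq inj_g[of x y] inj_g[of "- x" "- y"] neg_g[of x "- y"] nA[of x] nA[of y]
      by (auto simp: w_def split: if_splits)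
  qed
  have "bij_betw w (A \<union> ?N) (A \<union> ?N)"
    using endo_inj_surj[OF _ maps inj] inj by (simp add: bij_betw_def A_def)
  then have bij: "bij_betw w (signed_letters (n + m)) (signed_letters (n + m))"
    unfolding letters using bijL disj by (metis bij_betw_combine)
  have perm: "w permutes signed_letters (n + m)"
    using bij by (rule bij_imp_permutes) (use perm' letters wL in \<open>auto simp: permutes_not_in\<close>)
  have odd: "w (- x) = - w x" if "x \<in> signed_letters (n + m)" for x
  proof (cases "x \<in> ?L")
    case True
    then have "- x \<in> ?L" by (auto simp: signed_letters_def)
    then show ?thesis using True odd' by (simp add: wL')
  next
    case False
    then have "x \<in> A \<or> - x \<in> A" using that letters N by auto
    then show ?thesis using disjA N by (auto simp: w_def)
  qed
  have hyp: "w \<in> hyperoctahedral (n + m)"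
    using perm odd by (simp add: hyperoctahedral_def)
  \<comment> \<open>An orbit starts at the image of \<open>x\<close>; it returns to \<open>x\<close>
    because \<open>w\<close> is a permutation of finite support.\<close>
  have self: "x \<in> orbit w x" for x
    using perm finite_signed_letters permutes_imp_permutation permutation_self_in_orbit by metis
  have orbit_L: "orbit w x = orbit w' x" if "x \<in> ?L" for x
    by (rule orbit_cong0[OF that]) (use bijL wL' in \<open>auto simp: bij_betw_def\<close>)
  have orbit_subset: "orbit w x \<subseteq> C" if "x \<in> C" "w ` C \<subseteq> C" for x C
  proof
    fix y assume "y \<in> orbit w x"
    then show "y \<in> C" using that by induction auto
  qed
  let ?a = "int n + 1"
  have a: "?a \<in> A" using m by (simp add: A_def)
  have up: "x \<in> orbit w ?a" if "x \<in> A" for x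
  proof -
    have "?a \<le> x" using that by (simp add: A_def)
    then have "x \<le> int (n + m) \<longrightarrow> x \<in> orbit w ?a"
    proof (induction x rule: int_ge_induct)
      case base
      show ?case by (simp add: self)
    next
      case (step i)
      have "w i = i + 1" if "i + 1 \<le> int (n + m)"
        using that step.hyps by (simp add: w_def g_def A_def)
      then show ?case using step.IH orbit.step[of i w ?a] by auto
    qed
    then show ?thesis using that by (simp add: A_def)
  qed
  have cyc: "orbit w ` (A \<union> ?N) = (if b then {A \<union> uminus ` A} else {A, uminus ` A})"
  proof (cases b)
    case False
    \<comment> \<open>The shift closes up inside \<open>A\<close>, so \<open>A\<close> is one cycle;
      oddness carries it to the cycle \<open>?N\<close>.\<close>
    then have "w ` A \<subseteq> A" using m by (auto simp: w_def g_def A_def h_def)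
    then have "orbit w ?a = A" using orbit_subset[OF a] up by blast
    then have cA: "cyclic_on w A" using a by (metis cyclic_on_singleI)
    then have cN: "cyclic_on w ?N"
      by (rule cyclic_on_image) (use odd letters in auto)
    have "orbit w ` A = {A}" "orbit w ` ?N = {?N}"
      using orbit_cyclic_eq3[OF cA] orbit_cyclic_eq3[OF cN] a by (auto simp: image_iff)
    then show ?thesis using False by (simp add: image_Un insert_commute)
  next
    case True
    \<comment> \<open>The top letter is sent to \<open>- ?a\<close>, so the orbit of
      \<open>?a\<close> runs on into the orbit of \<open>- ?a\<close>, its mirror image by
      oddness.\<close>
    let ?b = "int (n + m)"
    have "?b \<in> A" using m by (simp add: A_def)
    moreover have "w ?b = - ?a" using True m by (simp add: w_def g_def h_def A_def)
    ultimately have neg: "- ?a \<in> orbit w ?a" using up orbit.step by metis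
    have "uminus ` orbit w ?a = orbit w (- ?a)"
    proof (rule orbit_inverse[OF self])
      fix x assume "x \<in> orbit w ?a"
      then have "x \<in> signed_letters (n + m)"
        using permutes_orbit_subset[OF perm] a letters by blast
      then show "w (- x) = - w x" by (rule odd)
    qed
    then have "?N \<subseteq> orbit w (- ?a)" using up by blast
    moreover have "orbit w (- ?a) \<subseteq> orbit w ?a"
      by (rule subsetI) (rule orbit_trans[OF _ neg])
    ultimately have "A \<union> ?N \<subseteq> orbit w ?a" using up by blast
    moreover have "orbit w ?a \<subseteq> A \<union> ?N" using a by (intro orbit_subset maps) simp
    ultimately have "orbit w ?a = A \<union> ?N" by (intro subset_antisym)
    then have "cyclic_on w (A \<union> ?N)" using a by (metis UnI1 cyclic_on_singleI)
    then have "orbit w x = A \<union> ?N" if "x \<in> A \<union> ?N" for x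
      using that by (rule orbit_cyclic_eq3)
    then have "orbit w ` (A \<union> ?N) = {A \<union> ?N}"
      using a by (auto simp: image_iff)
    then show ?thesis using True by simp
  qed
  have "cycles_of (n + m) w = orbit w ` ?L \<union> orbit w ` (A \<union> ?N)"
    by (simp add: cycles_of_def letters image_Un)
  also have "orbit w ` ?L = cycles_of n w'"
    unfolding cycles_of_def by (rule image_cong) (simp_all add: orbit_L)
  finally show ?thesis
    using hyp cyc by (intro bexI[of _ w]) simp_all
qed

lemma cycles_of_subset:
  assumes "w \<in> hyperoctahedral n" "c \<in> cycles_of n w"
  shows "c \<subseteq> signed_letters n"
  using assms permutes_orbit_subset[of w "signed_letters n"]
  by (fastforce simp: cycles_of_def hyperoctahedral_def)

lemma positive_cycles_eq_image:
  "positive_cycles n w = (\<lambda>c. {c, uminus ` c}) ` {c \<in> cycles_of n w. c \<inter> uminus ` c = {}}"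
  by (auto simp: positive_cycles_def)

lemma finite_positive_cycles: "finite (positive_cycles n w)"
  unfolding positive_cycles_eq_image cycles_of_def using finite_signed_letters by simp

lemma finite_negative_cycles: "finite (negative_cycles n w)"
  unfolding negative_cycles_def cycles_of_def using finite_signed_letters by simp

text \<open>Induction on the parts: each one adds a cycle or a mirror pair on fresh letters. The
  claim is first proved for multisets, where adding a part is a single insertion, and the sorting is
  applied at the end.\<close>

lemma exists_signed_cycle_type:
  assumes "\<gamma> \<in> signed_compositions n"
  shows "\<exists>w \<in> hyperoctahedral n. signed_cycle_type n w = composition_type \<gamma>"
proof -
  have "\<exists>w \<in> hyperoctahedral n.
      image_mset (\<lambda>P. card (\<Union> P) div 2) (mset_set (positive_cycles n w)) =
        mset (map fst (filter (\<lambda>p. \<not> snd p) \<gamma>)) \<and>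
      image_mset (\<lambda>c. card c div 2) (mset_set (negative_cycles n w)) =
        mset (map fst (filter snd \<gamma>))"
    using assms
  proof (induction \<gamma> arbitrary: n)
    case Nil
    have "signed_letters 0 = {}" by (auto simp: signed_letters_def)
    moreover have "n = 0" using Nil by (simp add: signed_compositions_def)
    ultimately show ?case
      by (intro bexI[of _ id])
        (auto simp: hyperoctahedral_def positive_cycles_def negative_cycles_def cycles_of_def
          permutes_def)
  next
    case (Cons p \<gamma>)
    obtain m b where p: "p = (m, b)" by fastforce
    define k where "k = sum_list (map fst \<gamma>)"
    have m: "m > 0" and n: "n = k + m" and \<gamma>: "\<gamma> \<in> signed_compositions k"
      using Cons.prems by (auto simp: signed_compositions_def p k_def)
    obtain w' where w': "w' \<in> hyperoctahedral k"
      and pos: "image_mset (\<lambda>P. card (\<Union> P) div 2) (mset_set (positive_cycles k w')) =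
        mset (map fst (filter (\<lambda>p. \<not> snd p) \<gamma>))"
      and neg: "image_mset (\<lambda>c. card c div 2) (mset_set (negative_cycles k w')) =
        mset (map fst (filter snd \<gamma>))"
      using Cons.IH[OF \<gamma>] by blast
    define A where "A = {int k + 1..int (k + m)}"
    let ?N = "uminus ` A"
    obtain w where w: "w \<in> hyperoctahedral n"
      and cyc: "cycles_of n w = cycles_of k w' \<union> (if b then {A \<union> ?N} else {A, ?N})"
      using hyperoctahedral_extend_cycle[OF w' m, of b] unfolding n A_def by blast
    have ne: "int k + 1 \<in> A" using m by (simp add: A_def)
    have NN: "uminus ` ?N = A" by (simp add: image_image)
    have disjA: "A \<inter> ?N = {}" by (auto simp: A_def)
    have cardA: "card A = m" by (simp add: A_def)
    have cardAN: "card (A \<union> ?N) = 2 * m"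
      using disjA cardA by (subst card_Un_disjoint) (auto simp: A_def card_image)
    \<comment> \<open>The fresh letter \<open>k + 1\<close> distinguishes the new cycles from all
      old ones, so each insertion below really adds an element to the multiset.\<close>
    have notin: "int k + 1 \<notin> c" if "c \<in> cycles_of k w'" for c
      using cycles_of_subset[OF w' that] by (auto simp: signed_letters_def)
    have notin': "int k + 1 \<notin> uminus ` c" if "c \<in> cycles_of k w'" for c
      using cycles_of_subset[OF w' that] by (auto simp: signed_letters_def)
    show ?case
    proof (cases b)
      case True
      have "positive_cycles n w = positive_cycles k w'"
        unfolding positive_cycles_eq_image cyc using True ne NN
        by (intro arg_cong[of _ _ "(`) _"]) (auto simp: image_Un)
      moreover have "negative_cycles n w = insert (A \<union> ?N) (negative_cycles k w')"
        unfolding negative_cycles_def cyc using True NN by (auto simp: image_Un)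
      moreover have "A \<union> ?N \<notin> negative_cycles k w'"
        using notin ne by (auto simp: negative_cycles_def)
      ultimately show ?thesis
        using w pos neg True cardAN p by (intro bexI[of _ w]) (simp_all add: finite_negative_cycles)
    next
      case False
      have nAN: "A \<noteq> ?N" using ne disjA by auto
      \<comment> \<open>Both new cycles generate the same pair, so there is only one new positive
        cycle; its \<open>2 * m\<close> letters give length \<open>m\<close>.\<close>
      have "{c \<in> cycles_of n w. c \<inter> uminus ` c = {}} =
          insert A (insert ?N {c \<in> cycles_of k w'. c \<inter> uminus ` c = {}})"
        unfolding cyc using False NN disjA by auto
      then have "positive_cycles n w = insert {A, ?N} (positive_cycles k w')"
        unfolding positive_cycles_eq_image by (simp add: NN insert_commute)
      moreover have "{A, ?N} \<notin> positive_cycles k w'"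
        using notin notin' ne unfolding positive_cycles_def by (auto simp: doubleton_eq_iff)
      moreover have "negative_cycles n w = negative_cycles k w'"
        unfolding negative_cycles_def cyc using False NN nAN by auto
      ultimately show ?thesis
        using w pos neg False cardAN p by (intro bexI[of _ w]) (simp_all add: finite_positive_cycles)
    qed
  qed
  then show ?thesis
    unfolding signed_cycle_type_def composition_type_def by metis
qed

subsection \<open>Uniqueness of the distribution\<close>

text \<open>Grouping \<open>B\<close> by encoded word turns the weight sum into a pairing with the
  multiplicity function, the form used for separation.\<close>

lemma sum_word_wt_eq:
  assumes "finite B" and "sDes \<in> B \<rightarrow> signed_sets n" and "\<gamma> \<in> signed_compositions n"
  shows "(\<Sum>b\<in>B. wt \<gamma> (sDes b)) =
    (\<Sum>xs\<in>words n. word_wt \<gamma> xs * int (card {b \<in> B. segment (sDes b) 0 n = xs}))"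
proof -
  have "(\<Sum>b\<in>B. wt \<gamma> (sDes b)) = (\<Sum>b\<in>B. word_wt \<gamma> (segment (sDes b) 0 n))"
    using assms by (intro sum.cong wt_eq_word_wt) auto
  also have "\<dots> = (\<Sum>xs\<in>words n. \<Sum>b\<in>{b \<in> B. segment (sDes b) 0 n = xs}.
      word_wt \<gamma> (segment (sDes b) 0 n))"
    using assms(1) finite_words by (intro sum.group[symmetric]) (auto simp: words_def)
  also have "\<dots> = (\<Sum>xs\<in>words n. word_wt \<gamma> xs * int (card {b \<in> B. segment (sDes b) 0 n = xs}))"
    by (intro sum.cong) (simp_all add: mult.commute)
  finally show ?thesis .
qed

theorem theorem4p4:
  fixes n :: nat
    and \<chi> :: "(int \<Rightarrow> int) \<Rightarrow> complex"
    and B :: "'b set" and sDes :: "'b \<Rightarrow> signed_set"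
    and B' :: "'c set" and sDes' :: "'c \<Rightarrow> signed_set"
  assumes "is_character n \<chi>"
    and "finite B" and "finite B'"
    and "fine_set n \<chi> B sDes"
    and "fine_set n \<chi> B' sDes'"
  shows "\<forall>\<sigma> \<in> signed_sets n. card {b \<in> B. sDes b = \<sigma>} = card {b \<in> B'. sDes' b = \<sigma>}"
proof
  fix \<sigma> assume \<sigma>: "\<sigma> \<in> signed_sets n"
  define c where "c xs = int (card {b \<in> B. segment (sDes b) 0 n = xs}) -
    int (card {b \<in> B'. segment (sDes' b) 0 n = xs})" for xs
  have D: "sDes \<in> B \<rightarrow> signed_sets n" and D': "sDes' \<in> B' \<rightarrow> signed_sets n"
    using assms(4,5) by (auto simp: fine_set_def)
  have "c (segment \<sigma> 0 n) = 0"
  proof (rule word_wt_separates[of n c])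
    fix xs assume "\<not> valid xs"
    then have "{b \<in> B. segment (sDes b) 0 n = xs} = {}" "{b \<in> B'. segment (sDes' b) 0 n = xs} = {}"
      using valid_segment D D' by blast+
    then show "c xs = 0" by (simp only: c_def card.empty)
  next
    fix \<gamma> assume \<gamma>: "\<gamma> \<in> signed_compositions n"
    obtain w where w: "w \<in> hyperoctahedral n" "signed_cycle_type n w = composition_type \<gamma>"
      using exists_signed_cycle_type[OF \<gamma>] by blast
    \<comment> \<open>One element \<open>w\<close> of type \<open>\<gamma>\<close> forces both sums
      to the same complex value, and integers embed injectively.\<close>
    have "of_int (\<Sum>b\<in>B. wt \<gamma> (sDes b)) = \<chi> w" "of_int (\<Sum>b\<in>B'. wt \<gamma> (sDes' b)) = \<chi> w"
      using assms(4,5) w \<gamma> by (auto simp: fine_set_def)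
    then have "(\<Sum>b\<in>B. wt \<gamma> (sDes b)) = (\<Sum>b\<in>B'. wt \<gamma> (sDes' b))"
      by (metis of_int_eq_iff)
    then show "(\<Sum>xs\<in>words n. word_wt \<gamma> xs * c xs) = 0"
      using sum_word_wt_eq[OF assms(2) D \<gamma>] sum_word_wt_eq[OF assms(3) D' \<gamma>]
      by (simp add: c_def right_diff_distrib sum_subtractf)
  qed simp
  \<comment> \<open>Injectivity of the encoding identifies the fibre over the word of
    \<open>\<sigma>\<close> with the fibre of \<open>sDes\<close> over
    \<open>\<sigma>\<close>.\<close>
  moreover have seg: "segment \<tau> 0 n = segment \<sigma> 0 n \<longleftrightarrow> \<tau> = \<sigma>" if "\<tau> \<in> signed_sets n" for \<tau>
    using inj_on_eq_iff[OF segment_inj_on that \<sigma>] .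
  have "{b \<in> B. segment (sDes b) 0 n = segment \<sigma> 0 n} = {b \<in> B. sDes b = \<sigma>}"
    "{b \<in> B'. segment (sDes' b) 0 n = segment \<sigma> 0 n} = {b \<in> B'. sDes' b = \<sigma>}"
    using seg[OF funcset_mem[OF D]] seg[OF funcset_mem[OF D']] by auto
  ultimately show "card {b \<in> B. sDes b = \<sigma>} = card {b \<in> B'. sDes' b = \<sigma>}"
    by (simp add: c_def)
qed

end
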